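(* For every integer $w>1$ there exists a two-dimensional poset $P$ of width $w$ with $\mathrm{qn}(P) \ge 2(w-1)$.
   Context: A poset $P=(X,<)$ is a finite set with a transitive, asymmetric relation. Its width is the maximum number of pairwise incomparable elements. A cover relation $a \prec b$ means $a<b$ and there is no $c$ with $a<c<b$; the cover graph $G_P$ has vertex set $X$ and an edge $\{a,b\}$ for each cover relation. A linear extension of $P$ is a total order $L$ of $X$ with $a <_L b$ whenever $a<_P b$. The dimension of $P$ is the least $d$ such that there are linear extensions (realizers) $L_1,\dots,L_d$ with $a<b$ in $P$ iff $a<b$ in every $L_i$. Given a total order $\sigma$ of the vertices of a graph, two edges $(u,v)$ and $(a,b)$ nest if $u<_\sigma a<_\sigma b<_\sigma v$; a $k$-queue layout is a vertex order together with a partition of the edges into $k$ sets (queues) such that no two edges in the same set nest. Equivalently, a $(k+1)$-rainbow is a set of $k+1$ pairwise nesting edges, and the minimum number of queues for a fixed order equals the maximum size of a rainbow in it. The queue number $\mathrm{qn}(P)$ of a poset $P$ is the smallest $k$ such that there is a linear extension $L$ of $P$ for which the cover graph $G_P$ with vertex order $L$ admits a $k$-queue layout (i.e., contains no $(k+1)$-rainbow). *)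

theory Defs
  imports Main
begin

text \<open>
  Orders are strict. A poset is a carrier \<open>X\<close> together with a relation \<open>r\<close> on \<open>X\<close>; the carrier is
  explicit because isolated points are not visible in \<open>r\<close>.
\<close>

definition finite_poset :: "'a set \<Rightarrow> 'a rel \<Rightarrow> bool" where
  "finite_poset X r \<longleftrightarrow> finite X \<and> r \<subseteq> X \<times> X \<and> trans r \<and> asym r"

definition antichain :: "'a set \<Rightarrow> 'a rel \<Rightarrow> 'a set \<Rightarrow> bool" where
  "antichain X r A \<longleftrightarrow> A \<subseteq> X \<and> (\<forall>a\<in>A. \<forall>b\<in>A. a \<noteq> b \<longrightarrow> (a, b) \<notin> r \<and> (b, a) \<notin> r)"

definition poset_width :: "'a set \<Rightarrow> 'a rel \<Rightarrow> nat" where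
  "poset_width X r = Max (card ` {A. antichain X r A})"

definition linear_extension :: "'a set \<Rightarrow> 'a rel \<Rightarrow> 'a rel \<Rightarrow> bool" where
  "linear_extension X r L \<longleftrightarrow> L \<subseteq> X \<times> X \<and> strict_linear_order_on X L \<and> r \<subseteq> L"

definition realizer :: "'a set \<Rightarrow> 'a rel \<Rightarrow> nat \<Rightarrow> (nat \<Rightarrow> 'a rel) \<Rightarrow> bool" where
  "realizer X r d L \<longleftrightarrow>
     (\<forall>i<d. linear_extension X r (L i)) \<and>
     (\<forall>a\<in>X. \<forall>b\<in>X. (a, b) \<in> r \<longleftrightarrow> (\<forall>i<d. (a, b) \<in> L i))"

definition poset_dimension :: "'a set \<Rightarrow> 'a rel \<Rightarrow> nat" where
  "poset_dimension X r = (LEAST d. \<exists>L. realizer X r d L)"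

definition covers :: "'a rel \<Rightarrow> 'a \<Rightarrow> 'a \<Rightarrow> bool" where
  "covers r a b \<longleftrightarrow> (a, b) \<in> r \<and> \<not> (\<exists>c. (a, c) \<in> r \<and> (c, b) \<in> r)"

definition cover_edges :: "'a rel \<Rightarrow> 'a set set" where
  "cover_edges r = {{a, b} | a b. covers r a b}"

text \<open>
  In \<open>nested L e f\<close> the edge \<open>f\<close> lies strictly inside \<open>e\<close> with respect to the vertex order \<open>L\<close>;
  in particular, edges with a common endpoint do not nest.
\<close>

definition nested :: "'a rel \<Rightarrow> 'a set \<Rightarrow> 'a set \<Rightarrow> bool" where
  "nested L e f \<longleftrightarrow>
     (\<exists>u v a b. e = {u, v} \<and> f = {a, b} \<and> (u, a) \<in> L \<and> (a, b) \<in> L \<and> (b, v) \<in> L)"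

text \<open>
  The partition of the edge set \<open>E\<close> into \<open>k\<close> queues is given by the map \<open>q\<close> that sends an edge to
  the index of its queue; queues may be empty.
\<close>

definition queue_layout :: "'a set set \<Rightarrow> 'a rel \<Rightarrow> nat \<Rightarrow> ('a set \<Rightarrow> nat) \<Rightarrow> bool" where
  "queue_layout E L k q \<longleftrightarrow>
     (\<forall>e\<in>E. q e < k) \<and> (\<forall>e\<in>E. \<forall>f\<in>E. q e = q f \<longrightarrow> \<not> nested L e f)"

definition queue_number :: "'a set \<Rightarrow> 'a rel \<Rightarrow> nat" where
  "queue_number X r =
     (LEAST k. \<exists>L q. linear_extension X r L \<and> queue_layout (cover_edges r) L k q)"

end

theory Submission
  imports Defs "HOL-Library.Nat_Bijection"
begin

text \<open>
  Consider a tower of posets in the plane and a chain \<open>Z\<close> to its left, where every element \<open>e\<close>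
  of the top floor \<open>B\<close> covers its own element \<open>z e\<close> of \<open>Z\<close>. If a linear extension puts these
  \<open>z e\<close> below some lower floor \<open>C\<close>, then either two edges \<open>{z e, e}\<close> nest around \<open>C\<close>, or the
  linear extension orders \<open>B\<close> as \<open>Z\<close> dictates. As \<open>C\<close> one takes the poset of width \<open>w - 1\<close> given by
  induction; \<open>B\<close> is a poset of width \<open>w - 1\<close> whose dictated order has a rainbow with
  \<open>2 * (w - 1) - 1\<close> edges, which the last edge \<open>{z e, e}\<close> encloses. A dual gadget at the bottom of
  the tower treats the linear extensions that put \<open>Z\<close> late.
\<close>

section \<open>Rainbows\<close>

definition rainbow :: "'a rel \<Rightarrow> 'a set set \<Rightarrow> bool" where
  "rainbow L F \<longleftrightarrow> (\<forall>e\<in>F. \<forall>f\<in>F. e \<noteq> f \<longrightarrow> nested L e f \<or> nested L f e)"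

lemma nestedI: "(u, a) \<in> L \<Longrightarrow> (a, b) \<in> L \<Longrightarrow> (b, v) \<in> L \<Longrightarrow> nested L {u, v} {a, b}"
  unfolding nested_def by (intro exI conjI) (rule refl | assumption)+

lemma nestedE:
  assumes "nested L e f"
  obtains u v a b where "e = {u, v}" "f = {a, b}" "(u, a) \<in> L" "(a, b) \<in> L" "(b, v) \<in> L"
  using assms unfolding nested_def by (elim exE conjE) (rule that)

lemma nested_converse_imp: "nested L e f \<Longrightarrow> nested (L\<inverse>) e f"
proof (elim nestedE)
  fix u v a b
  assume "e = {u, v}" "f = {a, b}" "(u, a) \<in> L" "(a, b) \<in> L" "(b, v) \<in> L"
  then show "nested (L\<inverse>) e f"
    using nestedI[of v b "L\<inverse>" a u] by (simp add: insert_commute)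
qed

lemma nested_converse: "nested (L\<inverse>) e f \<longleftrightarrow> nested L e f"
  using nested_converse_imp[of L e f] nested_converse_imp[of "L\<inverse>" e f]
  unfolding converse_converse by (rule iffI[rotated])

text \<open>Allows the lower end of the tower to be treated by the same argument as the upper end,
  in the reversed linear extension.\<close>

lemma rainbow_converse: "rainbow (L\<inverse>) F \<longleftrightarrow> rainbow L F"
  by (simp add: rainbow_def nested_converse)

lemma nested_mono:
  assumes "nested L e f" "e \<subseteq> A" "f \<subseteq> A" "Restr L A \<subseteq> M"
  shows "nested M e f"
  using assms(1)
proof (rule nestedE)
  fix u v a b
  assume *: "e = {u, v}" "f = {a, b}" "(u, a) \<in> L" "(a, b) \<in> L" "(b, v) \<in> L"
  then have "(u, a) \<in> M" "(a, b) \<in> M" "(b, v) \<in> M" using assms(2-4) by auto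
  with * show ?thesis by (simp add: nestedI)
qed

lemma rainbow_mono:
  assumes "rainbow L F" "\<And>e. e \<in> F \<Longrightarrow> e \<subseteq> A" "Restr L A \<subseteq> M"
  shows "rainbow M F"
  using assms nested_mono unfolding rainbow_def by metis

text \<open>The two descriptions of one edge share their endpoints, whereas nesting puts
  \<open>u\<close> strictly before both \<open>a\<close> and \<open>b\<close>.\<close>

lemma not_nested_self:
  assumes "trans L" "irrefl L"
  shows "\<not> nested L e e"
proof
  assume "nested L e e"
  then obtain u v a b where
    e: "e = {u, v}" "e = {a, b}" and L: "(u, a) \<in> L" "(a, b) \<in> L" "(b, v) \<in> L"
    by (rule nestedE)
  have "(u, b) \<in> L" using assms(1) L(1,2) by (rule transD)
  moreover have "u = a \<or> u = b" using e by (metis doubleton_eq_iff)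
  ultimately show False using assms(2) L(1) by (auto simp: irrefl_def)
qed

text \<open>An edge around all of \<open>F\<close> cannot belong to \<open>F\<close>, since no edge
  nests in itself; so the size really grows by one.\<close>

lemma rainbow_insert:
  assumes "trans L" "irrefl L" "rainbow L F" "finite F" "\<And>f. f \<in> F \<Longrightarrow> nested L e f"
  shows "rainbow L (insert e F)" "card (insert e F) = Suc (card F)"
  using assms not_nested_self[OF assms(1,2)] by (auto simp: rainbow_def card_insert_if)

text \<open>Pigeonhole: the edges of a rainbow lie in pairwise different queues.\<close>

lemma rainbow_card_le:
  assumes "rainbow L F" "F \<subseteq> E" "finite F" "queue_layout E L k q"
  shows "card F \<le> k"
proof -
  have "inj_on q F"
  proof (rule inj_onI, rule ccontr)
    fix e f assume "e \<in> F" "f \<in> F" "q e = q f" "e \<noteq> f"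
    then have "nested L e f \<or> nested L f e" "e \<in> E" "f \<in> E" "q f = q e"
      using assms(1,2) unfolding rainbow_def by auto
    then show False
      using assms(4) \<open>q e = q f\<close> unfolding queue_layout_def by blast
  qed
  moreover have "q ` F \<subseteq> {..<k}"
    using assms unfolding queue_layout_def by auto
  ultimately have "card F \<le> card {..<k}"
    by (intro card_inj_on_le[of q]) auto
  then show ?thesis by simp
qed

text \<open>
  If the linear order \<open>L\<close> inverts some pair of \<open>B\<close> with respect to \<open>k\<close>, the two edges \<open>{z e, e}\<close>
  of this pair nest around \<open>C\<close>; otherwise the rainbow of \<open>B\<close> with respect to \<open>k\<close> is a rainbow
  of \<open>L\<close> and lies below the edge \<open>{z t, t}\<close>.
\<close>

lemma gate_rainbow:
  fixes k :: "'a \<Rightarrow> int"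
  assumes L: "trans L" "irrefl L"
    and FC: "rainbow L FC" "FC \<subseteq> E" "finite FC" "card FC = n"
      "\<And>f. f \<in> FC \<Longrightarrow> \<exists>a\<in>C. \<exists>b\<in>C. f = {a, b} \<and> (a, b) \<in> L"
    and FB: "rainbow {(a, b). k a < k b} FB" "FB \<subseteq> E" "finite FB" "card FB = Suc n"
      "\<And>f. f \<in> FB \<Longrightarrow> \<exists>a\<in>B. \<exists>b\<in>B. f = {a, b} \<and> k a < k b \<and> k b < k t"
    and t: "t \<in> B" and k: "inj_on k B"
    and total: "\<And>e f. e \<in> B \<Longrightarrow> f \<in> B \<Longrightarrow> e \<noteq> f \<Longrightarrow> (e, f) \<in> L \<or> (f, e) \<in> L"
    and zE: "\<And>e. e \<in> B \<Longrightarrow> {z e, e} \<in> E"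
    and zz: "\<And>e f. e \<in> B \<Longrightarrow> f \<in> B \<Longrightarrow> k e < k f \<Longrightarrow> (z e, z f) \<in> L"
    and zC: "\<And>e c. e \<in> B \<Longrightarrow> c \<in> C \<Longrightarrow> (z e, c) \<in> L"
    and CB: "\<And>e c. e \<in> B \<Longrightarrow> c \<in> C \<Longrightarrow> (c, e) \<in> L"
    and "C \<noteq> {}"
  shows "\<exists>F \<subseteq> E. finite F \<and> rainbow L F \<and> card F = Suc (Suc n)"
proof -
  \<comment> \<open>Passing through any one element of \<open>C\<close> suffices; this is where
    \<open>C\<close> must be nonempty.\<close>
  have zB: "(z e, f) \<in> L" if "e \<in> B" "f \<in> B" for e f
    using \<open>C \<noteq> {}\<close> zC CB that L(1) by (meson all_not_in_conv transD)
  show ?thesis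
  proof (cases "\<exists>e\<in>B. \<exists>f\<in>B. k e < k f \<and> (f, e) \<in> L")
    case True
    then obtain e f where ef: "e \<in> B" "f \<in> B" "k e < k f" "(f, e) \<in> L" by blast
    have inner: "nested L {z x, x} c" if "x \<in> B" "c \<in> FC" for x c
    proof -
      obtain a b where "a \<in> C" "b \<in> C" "c = {a, b}" "(a, b) \<in> L" using FC(5) \<open>c \<in> FC\<close> by blast
      then show ?thesis using zC CB \<open>x \<in> B\<close> by (simp add: nestedI)
    qed
    have outer: "nested L {z e, e} {z f, f}"
      using ef zz zB by (simp add: nestedI)
    have F1: "rainbow L (insert {z f, f} FC)" "card (insert {z f, f} FC) = Suc n"
      using rainbow_insert[OF L FC(1,3)] inner ef FC(4) by auto
    have "rainbow L (insert {z e, e} (insert {z f, f} FC))"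
      "card (insert {z e, e} (insert {z f, f} FC)) = Suc (Suc n)"
      using rainbow_insert[OF L F1(1), of "{z e, e}"] inner outer ef FC(3) F1(2) by auto
    then show ?thesis
      using FC(2,3) zE ef by (intro exI[of _ "insert {z e, e} (insert {z f, f} FC)"]) auto
  next
    case False
    have mono: "(a, b) \<in> L" if "a \<in> B" "b \<in> B" "k a < k b" for a b
      using False total that by fastforce
    have "rainbow L FB"
      using FB(5) mono by (intro rainbow_mono[OF FB(1), of B]) fastforce+
    moreover have "nested L {z t, t} c" if "c \<in> FB" for c
    proof -
      obtain a b where "a \<in> B" "b \<in> B" "c = {a, b}" "k a < k b" "k b < k t"
        using FB(5) \<open>c \<in> FB\<close> by blast
      then show ?thesis using mono zB t by (simp add: nestedI)
    qed
    ultimately have "rainbow L (insert {z t, t} FB)" "card (insert {z t, t} FB) = Suc (Suc n)"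
      using rainbow_insert[OF L, of FB "{z t, t}"] FB(3,4) by auto
    then show ?thesis
      using FB(2,3) zE t by (intro exI[of _ "insert {z t, t} FB"]) auto
  qed
qed

section \<open>Chain covers and linear extensions\<close>

text \<open>A partition into at most \<open>w\<close> chains, written as a colouring with possibly
  empty classes. It bounds the width from above (the easy half of Dilworth's theorem) and composes
  directly when posets are stacked or put side by side.\<close>

definition chain_cover :: "'a set \<Rightarrow> 'a rel \<Rightarrow> nat \<Rightarrow> bool" where
  "chain_cover X r w \<longleftrightarrow> (\<exists>c::'a \<Rightarrow> nat. (\<forall>a\<in>X. c a < w) \<and>
     (\<forall>a\<in>X. \<forall>b\<in>X. c a = c b \<longrightarrow> a = b \<or> (a, b) \<in> r \<or> (b, a) \<in> r))"

lemma chain_coverI: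
  assumes "\<And>a. a \<in> X \<Longrightarrow> c a < w"
    and "\<And>a b. a \<in> X \<Longrightarrow> b \<in> X \<Longrightarrow> c a = c b \<Longrightarrow> a = b \<or> (a, b) \<in> r \<or> (b, a) \<in> r"
  shows "chain_cover X r w"
  unfolding chain_cover_def using assms by (intro exI[of _ c] conjI ballI impI)

lemma chain_coverE:
  assumes "chain_cover X r w"
  obtains c :: "'a \<Rightarrow> nat" where "\<forall>a\<in>X. c a < w"
    "\<forall>a\<in>X. \<forall>b\<in>X. c a = c b \<longrightarrow> a = b \<or> (a, b) \<in> r \<or> (b, a) \<in> r"
proof -
  from assms obtain c where c: "(\<forall>a\<in>X. c a < w) \<and>
     (\<forall>a\<in>X. \<forall>b\<in>X. c a = c b \<longrightarrow> a = b \<or> (a, b) \<in> r \<or> (b, a) \<in> r)"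
    unfolding chain_cover_def ..
  show thesis by (rule that[of c]) (use c in simp_all)
qed

lemma chain_cover_converse: "chain_cover X (r\<inverse>) w \<longleftrightarrow> chain_cover X r w"
  by (simp add: chain_cover_def disj_commute)

text \<open>Chains of the same colour are concatenated, so stacking needs no new colour.\<close>

lemma chain_cover_series:
  assumes X: "chain_cover X r w" and Y: "chain_cover Y r w"
    and XY: "\<And>a b. a \<in> X \<Longrightarrow> b \<in> Y \<Longrightarrow> (a, b) \<in> r"
  shows "chain_cover (X \<union> Y) r w"
proof -
  obtain c where c: "\<forall>a\<in>X. c a < w"
    "\<forall>a\<in>X. \<forall>b\<in>X. c a = c b \<longrightarrow> a = b \<or> (a, b) \<in> r \<or> (b, a) \<in> r"
    by (rule chain_coverE[OF X])
  obtain d where d: "\<forall>a\<in>Y. d a < w"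
    "\<forall>a\<in>Y. \<forall>b\<in>Y. d a = d b \<longrightarrow> a = b \<or> (a, b) \<in> r \<or> (b, a) \<in> r"
    by (rule chain_coverE[OF Y])
  define e where "e = (\<lambda>a. if a \<in> X then c a else d a)"
  have "e a < w" if "a \<in> X \<union> Y" for a
    using that c(1) d(1) by (auto simp: e_def)
  moreover have "a = b \<or> (a, b) \<in> r \<or> (b, a) \<in> r"
    if "a \<in> X \<union> Y" "b \<in> X \<union> Y" "e a = e b" for a b
    using that c(2) d(2) XY by (cases "a \<in> X"; cases "b \<in> X") (auto simp: e_def)
  ultimately show ?thesis by (rule chain_coverI)
qed

text \<open>The set \<open>Y\<close> is a single chain and receives the new colour
  \<open>w\<close>.\<close>

lemma chain_cover_parallel:
  assumes X: "chain_cover X r w"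
    and Y: "\<And>a b. a \<in> Y \<Longrightarrow> b \<in> Y \<Longrightarrow> a = b \<or> (a, b) \<in> r \<or> (b, a) \<in> r"
  shows "chain_cover (X \<union> Y) r (Suc w)"
proof -
  obtain c where c: "\<forall>a\<in>X. c a < w"
    "\<forall>a\<in>X. \<forall>b\<in>X. c a = c b \<longrightarrow> a = b \<or> (a, b) \<in> r \<or> (b, a) \<in> r"
    by (rule chain_coverE[OF X])
  define e where "e = (\<lambda>a. if a \<in> X then c a else w)"
  have "e a < Suc w" if "a \<in> X \<union> Y" for a
    using that c(1) by (auto simp: e_def less_Suc_eq)
  moreover have "a = b \<or> (a, b) \<in> r \<or> (b, a) \<in> r"
    if "a \<in> X \<union> Y" "b \<in> X \<union> Y" "e a = e b" for a b
  proof (cases "a \<in> X \<longleftrightarrow> b \<in> X")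
    case True
    then show ?thesis using that c(2) Y[of a b] by (cases "a \<in> X") (simp_all add: e_def)
  next
    case False
    then show ?thesis using that c(1) by (auto simp: e_def)
  qed
  ultimately show ?thesis by (rule chain_coverI)
qed

lemma chain_cover_singleton: "0 < w \<Longrightarrow> chain_cover {a} r w"
  by (rule chain_coverI[of _ "\<lambda>_. 0"]) auto

lemma antichain_subset: "antichain X r A \<Longrightarrow> A \<subseteq> X"
  by (simp add: antichain_def)

lemma antichainD: "antichain X r A \<Longrightarrow> a \<in> A \<Longrightarrow> b \<in> A \<Longrightarrow> a \<noteq> b \<Longrightarrow> (a, b) \<notin> r"
  unfolding antichain_def by blast

lemma antichain_card_le:
  assumes X: "chain_cover X r w" and A: "antichain X (Restr r X) A"
  shows "card A \<le> w"
proof -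
  obtain c where c: "\<forall>a\<in>X. c a < w"
    "\<forall>a\<in>X. \<forall>b\<in>X. c a = c b \<longrightarrow> a = b \<or> (a, b) \<in> r \<or> (b, a) \<in> r"
    by (rule chain_coverE[OF X])
  have "inj_on c A"
    using c(2) A unfolding inj_on_def antichain_def by blast
  moreover have "c ` A \<subseteq> {..<w}"
    using c(1) A unfolding antichain_def by blast
  ultimately have "card A \<le> card {..<w}"
    by (intro card_inj_on_le[of c]) auto
  then show ?thesis by simp
qed

section \<open>Restriction to subsets and cover edges of convex subsets\<close>

lemma linear_extension_restrict:
  assumes "linear_extension X r L" "Y \<subseteq> X"
  shows "linear_extension Y (Restr r Y) (Restr L Y)"
proof -
  have L: "trans L" "irrefl L" "total_on X L" "r \<subseteq> L"
    using assms(1) unfolding linear_extension_def strict_linear_order_on_def by auto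
  have "total_on Y (Restr L Y)"
  proof (rule total_onI)
    fix x y assume "x \<in> Y" "y \<in> Y" "x \<noteq> y"
    then show "(x, y) \<in> Restr L Y \<or> (y, x) \<in> Restr L Y"
      using L(3) assms(2) by (auto simp: total_on_def)
  qed
  moreover have "trans (Restr L Y)" using L(1) by (rule trans_Restr)
  moreover have "irrefl (Restr L Y)" using L(2) by (auto simp: irrefl_def)
  moreover have "Restr r Y \<subseteq> Restr L Y" using L(4) by blast
  ultimately show ?thesis
    unfolding linear_extension_def strict_linear_order_on_def by simp
qed

text \<open>Any element of \<open>X\<close> between \<open>a\<close> and \<open>b\<close> would
  already lie in \<open>Y\<close>. The floors of the tower are convex, so their cover edges survive
  in the whole poset.\<close>

lemma covers_convex:
  assumes ab: "covers (Restr r Y) a b" and "Y \<subseteq> X"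
    and convex: "\<And>a b x. a \<in> Y \<Longrightarrow> b \<in> Y \<Longrightarrow> x \<in> X \<Longrightarrow> (a, x) \<in> r \<Longrightarrow> (x, b) \<in> r \<Longrightarrow> x \<in> Y"
  shows "covers (Restr r X) a b"
proof -
  have Y: "a \<in> Y" "b \<in> Y" "(a, b) \<in> r" using ab by (auto simp: covers_def)
  have "False" if "(a, x) \<in> Restr r X" "(x, b) \<in> Restr r X" for x
    using ab convex[OF Y(1,2), of x] that Y by (auto simp: covers_def)
  then show ?thesis using Y assms(2) by (auto simp: covers_def)
qed

lemma cover_edges_convex:
  assumes "Y \<subseteq> X"
    and "\<And>a b x. a \<in> Y \<Longrightarrow> b \<in> Y \<Longrightarrow> x \<in> X \<Longrightarrow> (a, x) \<in> r \<Longrightarrow> (x, b) \<in> r \<Longrightarrow> x \<in> Y"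
  shows "cover_edges (Restr r Y) \<subseteq> cover_edges (Restr r X)"
proof
  fix e assume "e \<in> cover_edges (Restr r Y)"
  then obtain a b where "e = {a, b}" "covers (Restr r Y) a b"
    unfolding cover_edges_def by blast
  moreover from this(2) have "covers (Restr r X) a b"
    using assms by (rule covers_convex)
  ultimately show "e \<in> cover_edges (Restr r X)"
    unfolding cover_edges_def by blast
qed

lemma cover_edgesE:
  assumes "e \<in> cover_edges (Restr r X)"
  obtains a b where "a \<in> X" "b \<in> X" "e = {a, b}" "(a, b) \<in> r"
  using assms unfolding cover_edges_def covers_def by blast

lemma cover_edges_converse: "cover_edges (r\<inverse>) = cover_edges r"
  unfolding cover_edges_def covers_def by (auto simp: insert_commute)

lemma Restr_converse: "Restr (r\<inverse>) X = (Restr r X)\<inverse>"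
  by auto

section \<open>Planar point sets\<close>

text \<open>The strict dominance order of the plane. Integer coordinates permit translations,
  reflections, and points in adjacent rows or columns with nothing between them.\<close>

definition below :: "('a \<Rightarrow> int) \<Rightarrow> ('a \<Rightarrow> int) \<Rightarrow> 'a rel" where
  "below g h = {(a, b). g a < g b \<and> h a < h b}"

lemma in_below [simp]: "(a, b) \<in> below g h \<longleftrightarrow> g a < g b \<and> h a < h b"
  by (simp add: below_def)

text \<open>Both coordinates share one interval, so boxes over successive disjoint intervals are
  stacked along the diagonal.\<close>

definition in_box :: "('a \<Rightarrow> int) \<Rightarrow> ('a \<Rightarrow> int) \<Rightarrow> int \<Rightarrow> int \<Rightarrow> 'a set \<Rightarrow> bool" where
  "in_box g h l u X \<longleftrightarrow> (\<forall>p\<in>X. l \<le> g p \<and> g p \<le> u \<and> l \<le> h p \<and> h p \<le> u)"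

text \<open>The point type stays abstract so that the reflected plane is another instance and the
  final poset can consist of natural numbers.\<close>

locale plane =
  fixes g h :: "'a \<Rightarrow> int" and pt :: "int \<Rightarrow> int \<Rightarrow> 'a"
  assumes g_pt [simp]: "g (pt x y) = x" and h_pt [simp]: "h (pt x y) = y"
begin

lemma pt_eq_iff [simp]: "pt x y = pt x' y' \<longleftrightarrow> x = x' \<and> y = y'"
  by (metis g_pt h_pt)

abbreviation R :: "'a rel" where "R \<equiv> below g h"

text \<open>
  The linear extension of \<open>B\<close> given by \<open>h\<close> alone has a rainbow with \<open>2 * v - 1\<close> edges although
  \<open>B\<close> has width \<open>v\<close>: in the induction step the \<open>h\<close>-order is \<open>y x1 B x2 x3\<close>, the \<open>g\<close>-order
  is \<open>x1 x2 y x3 B\<close>, and the new edges are \<open>{y, x3}\<close> and \<open>{x1, x2}\<close>.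
\<close>

lemma h_rainbow_exists:
  "\<exists>K. \<forall>N. \<exists>B F. finite B \<and> in_box g h N (N + K) B \<and> inj_on h B \<and> chain_cover B R (Suc v) \<and>
     F \<subseteq> cover_edges (Restr R B) \<and> finite F \<and> card F = Suc (2 * v) \<and>
     rainbow {(a, b). h a < h b} F"
proof (induction v)
  case 0
  show ?case
  proof (intro exI[of _ 1] allI)
    fix N :: int
    define a b where ab: "a = pt N N" "b = pt (N + 1) (N + 1)"
    have "chain_cover ({a} \<union> {b}) R (Suc 0)"
      by (intro chain_cover_series chain_cover_singleton) (simp_all add: ab)
    then have "chain_cover {a, b} R (Suc 0)" by (simp add: insert_commute)
    moreover have "covers (Restr R {a, b}) a b"
      using ab by (auto simp: covers_def)
    ultimately show "\<exists>B F. finite B \<and> in_box g h N (N + 1) B \<and> inj_on h B \<and>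
        chain_cover B R (Suc 0) \<and> F \<subseteq> cover_edges (Restr R B) \<and> finite F \<and>
        card F = Suc (2 * 0) \<and> rainbow {(a, b). h a < h b} F"
      using ab by (intro exI[of _ "{a, b}"] exI[of _ "{{a, b}}"])
        (auto simp: in_box_def rainbow_def cover_edges_def)
  qed
next
  case (Suc v)
  then obtain K where K: "\<And>N. \<exists>B F. finite B \<and> in_box g h N (N + K) B \<and> inj_on h B \<and>
     chain_cover B R (Suc v) \<and> F \<subseteq> cover_edges (Restr R B) \<and> finite F \<and>
     card F = Suc (2 * v) \<and> rainbow {(a, b). h a < h b} F" by blast
  show ?case
  proof (intro exI[of _ "\<bar>K\<bar> + 6"] allI)
    fix N :: int
    \<comment> \<open>The size \<open>K\<close> does not depend on the position, so the old block
      can be shifted by 4; this frees the columns \<open>N\<close> to \<open>N + 3\<close> for the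
      new points.\<close>
    obtain B F where B: "finite B" "in_box g h (N + 4) (N + 4 + K) B" "inj_on h B"
      "chain_cover B R (Suc v)" "F \<subseteq> cover_edges (Restr R B)" "finite F" "card F = Suc (2 * v)"
      "rainbow {(a, b). h a < h b} F"
      using K[of "N + 4"] by blast
    \<comment> \<open>The induction hypothesis does not fix the sign of \<open>K\<close>.\<close>
    define J where "J = \<bar>K\<bar>"
    have box: "N + 4 \<le> g p" "g p \<le> N + 4 + J" "N + 4 \<le> h p" "h p \<le> N + 4 + J" if "p \<in> B" for p
      using B(2) that unfolding in_box_def J_def by fastforce+
    have J: "0 \<le> J" by (simp add: J_def)
    define x1 x2 x3 y where xy: "x1 = pt N (N + 1)" "x2 = pt (N + 1) (N + J + 5)"
      "x3 = pt (N + 3) (N + J + 6)" "y = pt (N + 2) N"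
    define B' where "B' = ({y} \<union> B) \<union> {x1, x2, x3}"
    define F1 where "F1 = insert {x1, x2} F"
    have L: "trans {(a, b). h a < h b}" "irrefl {(a, b). h a < h b}"
      by (auto simp: trans_def irrefl_def)
    have F: "\<exists>a\<in>B. \<exists>b\<in>B. f = {a, b} \<and> h a < h b" if "f \<in> F" for f
      using cover_edgesE[OF subsetD[OF B(5) that]] by (metis in_below)
    have nest: "nested {(a, b). h a < h b} {x1, x2} f" "nested {(a, b). h a < h b} {y, x3} f"
      if f: "f \<in> F" for f
    proof -
      obtain a b where ab: "a \<in> B" "b \<in> B" "f = {a, b}" "h a < h b" using F[OF f] by blast
      have "h x1 < h a" "h b < h x2" "h y < h a" "h b < h x3"
        using box[OF ab(1)] box[OF ab(2)] by (auto simp: xy)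
      with ab show "nested {(a, b). h a < h b} {x1, x2} f" "nested {(a, b). h a < h b} {y, x3} f"
        by (auto intro: nestedI)
    qed
    have nest2: "nested {(a, b). h a < h b} {y, x3} {x1, x2}"
      by (rule nestedI) (use J in \<open>auto simp: xy\<close>)
    have F1: "rainbow {(a, b). h a < h b} F1" "card F1 = Suc (Suc (2 * v))" "finite F1"
      using rainbow_insert[OF L B(8,6), of "{x1, x2}"] nest B(6,7) by (auto simp: F1_def)
    have F2: "rainbow {(a, b). h a < h b} (insert {y, x3} F1)"
        "card (insert {y, x3} F1) = Suc (2 * Suc v)"
      using rainbow_insert[OF L F1(1,3), of "{y, x3}"] nest nest2 F1(2) by (auto simp: F1_def)
    \<comment> \<open>Each pair occupies two consecutive columns, so no point fits between its
      members.\<close>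
    have "covers (Restr R B') x1 x2" "covers (Restr R B') y x3"
      using J by (auto simp: covers_def B'_def xy)
    then have "{x1, x2} \<in> cover_edges (Restr R B')" "{y, x3} \<in> cover_edges (Restr R B')"
      unfolding cover_edges_def by blast+
    moreover have "cover_edges (Restr R B) \<subseteq> cover_edges (Restr R B')"
    proof (rule cover_edges_convex)
      fix a b x assume "a \<in> B" "b \<in> B" "x \<in> B'" "(a, x) \<in> R" "(x, b) \<in> R"
      \<comment> \<open>All new points lie to the left of \<open>B\<close>, so none of them is above
        a point of \<open>B\<close>.\<close>
      then show "x \<in> B" using box[of a] by (auto simp: B'_def xy)
    qed (auto simp: B'_def)
    ultimately have edges: "insert {y, x3} F1 \<subseteq> cover_edges (Restr R B')"
      using B(5) by (auto simp: F1_def)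
    \<comment> \<open>The point \<open>y\<close> is below all of \<open>B\<close> and prolongs an
      old chain; only \<open>x1\<close>, \<open>x2\<close>, \<open>x3\<close> need a new one. Thus
      two more edges cost a single chain.\<close>
    have "chain_cover ({y} \<union> B) R (Suc v)"
    proof (intro chain_cover_series chain_cover_singleton B(4))
      fix a b assume "a \<in> {y}" "b \<in> B"
      then show "(a, b) \<in> R" using box[of b] by (simp add: xy)
    qed simp
    then have chains: "chain_cover B' R (Suc (Suc v))"
      unfolding B'_def by (rule chain_cover_parallel) (use J in \<open>auto simp: xy\<close>)
    have "inj_on h B'"
      using B(3) J by (auto simp: B'_def xy dest: box(3,4))
    moreover have "in_box g h N (N + (\<bar>K\<bar> + 6)) B'"
      unfolding in_box_def J_def[symmetric]
    proof
      fix p assume "p \<in> B'"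
      then consider "p \<in> B" | "p \<in> {y, x1, x2, x3}" by (auto simp: B'_def)
      then show "N \<le> g p \<and> g p \<le> N + (J + 6) \<and> N \<le> h p \<and> h p \<le> N + (J + 6)"
        by cases (use box[of p] J in \<open>auto simp: xy\<close>)
    qed
    ultimately show "\<exists>B F. finite B \<and> in_box g h N (N + (\<bar>K\<bar> + 6)) B \<and> inj_on h B \<and>
        chain_cover B R (Suc (Suc v)) \<and> F \<subseteq> cover_edges (Restr R B) \<and> finite F \<and>
        card F = Suc (2 * Suc v) \<and> rainbow {(a, b). h a < h b} F"
      using F2 edges chains B(1) F1(3)
      by (intro exI[of _ B'] exI[of _ "insert {y, x3} F1"]) (simp add: B'_def)
  qed
qed

text \<open>A point \<open>t\<close> is put above the whole block, at no cost in chains. Its edge to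
  the left chain is the one that encloses the rainbow in \<open>gate_rainbow\<close>.\<close>

lemma topped_h_rainbow_exists:
  "\<exists>K\<ge>0. \<forall>N. \<exists>B F t. finite B \<and> in_box g h N (N + K) B \<and> inj_on h B \<and>
     chain_cover B R (Suc v) \<and> F \<subseteq> cover_edges (Restr R B) \<and> finite F \<and> card F = Suc (2 * v) \<and>
     rainbow {(a, b). h a < h b} F \<and> t \<in> B \<and>
     (\<forall>f\<in>F. \<exists>a\<in>B. \<exists>b\<in>B. f = {a, b} \<and> h a < h b \<and> h b < h t)"
proof -
  obtain K where K: "\<And>N. \<exists>B F. finite B \<and> in_box g h N (N + K) B \<and> inj_on h B \<and>
     chain_cover B R (Suc v) \<and> F \<subseteq> cover_edges (Restr R B) \<and> finite F \<and>
     card F = Suc (2 * v) \<and> rainbow {(a, b). h a < h b} F"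
    using h_rainbow_exists by metis
  show ?thesis
  proof (intro exI[of _ "\<bar>K\<bar> + 1"] conjI allI)
    fix N :: int
    obtain B F where B: "finite B" "in_box g h N (N + K) B" "inj_on h B"
      "chain_cover B R (Suc v)" "F \<subseteq> cover_edges (Restr R B)" "finite F" "card F = Suc (2 * v)"
      "rainbow {(a, b). h a < h b} F"
      using K[of N] by blast
    define J where "J = \<bar>K\<bar>"
    have box: "N \<le> g p" "g p \<le> N + J" "N \<le> h p" "h p \<le> N + J" if "p \<in> B" for p
      using B(2) that unfolding in_box_def J_def by fastforce+
    have J: "0 \<le> J" by (simp add: J_def)
    define t where t: "t = pt (N + J + 1) (N + J + 1)"
    have "cover_edges (Restr R B) \<subseteq> cover_edges (Restr R (B \<union> {t}))"
    proof (rule cover_edges_convex)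
      fix a b x assume "a \<in> B" "b \<in> B" "x \<in> B \<union> {t}" "(a, x) \<in> R" "(x, b) \<in> R"
      then show "x \<in> B" using box[of b] by (auto simp: t)
    qed auto
    then have "F \<subseteq> cover_edges (Restr R (B \<union> {t}))" using B(5) by blast
    moreover have "chain_cover (B \<union> {t}) R (Suc v)"
    proof (intro chain_cover_series chain_cover_singleton B(4))
      fix a b assume "a \<in> B" "b \<in> {t}"
      then show "(a, b) \<in> R" using box[of a] by (simp add: t)
    qed simp
    moreover have "inj_on h (B \<union> {t})"
      using B(3) by (auto simp: t dest: box(4))
    moreover have "in_box g h N (N + (\<bar>K\<bar> + 1)) (B \<union> {t})"
      unfolding in_box_def J_def[symmetric]
    proof
      fix p assume "p \<in> B \<union> {t}"
      then show "N \<le> g p \<and> g p \<le> N + (J + 1) \<and> N \<le> h p \<and> h p \<le> N + (J + 1)"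
        using box[of p] J by (auto simp: t)
    qed
    moreover have "\<exists>a\<in>B \<union> {t}. \<exists>b\<in>B \<union> {t}. f = {a, b} \<and> h a < h b \<and> h b < h t" if f: "f \<in> F" for f
    proof -
      obtain a b where "a \<in> B" "b \<in> B" "f = {a, b}" "(a, b) \<in> R"
        by (rule cover_edgesE[OF subsetD[OF B(5) f]])
      moreover from this have "h a < h b" "h b < h t" using box[of b] by (simp_all add: t)
      ultimately show ?thesis by blast
    qed
    ultimately show "\<exists>B F t. finite B \<and> in_box g h N (N + (\<bar>K\<bar> + 1)) B \<and> inj_on h B \<and>
       chain_cover B R (Suc v) \<and> F \<subseteq> cover_edges (Restr R B) \<and> finite F \<and> card F = Suc (2 * v) \<and>
       rainbow {(a, b). h a < h b} F \<and> t \<in> B \<and>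
       (\<forall>f\<in>F. \<exists>a\<in>B. \<exists>b\<in>B. f = {a, b} \<and> h a < h b \<and> h b < h t)"
      using B(1,6,7,8) by (intro exI[of _ "B \<union> {t}"] exI[of _ F] exI[of _ t]) simp
  qed simp
qed

end

section \<open>Reflection in the antidiagonal\<close>

text \<open>The reflection reverses dominance and exchanges rows with columns, but keeps the upper
  left side in place. Hence the reflected gadget can be attached to the same chain on the left of
  the tower.\<close>

lemma (in plane) plane_dual: "plane (\<lambda>p. - h p) (\<lambda>p. - g p) (\<lambda>x y. pt (- y) (- x))"
  by unfold_locales simp_all

lemma below_dual: "below (\<lambda>p. - h p) (\<lambda>p. - g p) = (below g h)\<inverse>"
  by (auto simp: below_def)

lemma in_box_dual:
  "in_box (\<lambda>p. - h p) (\<lambda>p. - g p) l u X \<longleftrightarrow> in_box g h (- u) (- l) X"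
  unfolding in_box_def by (intro ball_cong refl) linarith

context plane
begin

lemma bottomed_g_rainbow_exists:
  "\<exists>K\<ge>0. \<forall>N. \<exists>B F t. finite B \<and> in_box g h N (N + K) B \<and> inj_on g B \<and>
     chain_cover B R (Suc v) \<and> F \<subseteq> cover_edges (Restr R B) \<and> finite F \<and> card F = Suc (2 * v) \<and>
     rainbow {(a, b). - g a < - g b} F \<and> t \<in> B \<and>
     (\<forall>f\<in>F. \<exists>a\<in>B. \<exists>b\<in>B. f = {a, b} \<and> - g a < - g b \<and> - g b < - g t)"
proof -
  interpret dual: plane "\<lambda>p. - h p" "\<lambda>p. - g p" "\<lambda>x y. pt (- y) (- x)"
    by (rule plane_dual)
  obtain K where K: "K \<ge> 0" "\<forall>N. \<exists>B F t. finite B \<and> in_box g h (- (N + K)) (- N) B \<and>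
     inj_on (\<lambda>p. - g p) B \<and> chain_cover B R (Suc v) \<and> F \<subseteq> cover_edges (Restr R B) \<and> finite F \<and>
     card F = Suc (2 * v) \<and> rainbow {(a, b). - g a < - g b} F \<and> t \<in> B \<and>
     (\<forall>f\<in>F. \<exists>a\<in>B. \<exists>b\<in>B. f = {a, b} \<and> - g a < - g b \<and> - g b < - g t)"
    using dual.topped_h_rainbow_exists[of v]
    unfolding below_dual chain_cover_converse Restr_converse cover_edges_converse in_box_dual
    by blast
  have "inj_on (\<lambda>p. - g p) B \<longleftrightarrow> inj_on g B" for B
    by (simp add: inj_on_def)
  then show ?thesis
    \<comment> \<open>The box of side \<open>K\<close> starting at \<open>- (N + K)\<close> is
      reflected to the one starting at \<open>N\<close>.\<close>
    using K(1) K(2)[rule_format, of "- (N + K)" for N] by (intro exI[of _ K]) (simp add: add.commute)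
qed

section \<open>Posets with a large rainbow in every linear extension\<close>

definition forces_rainbow :: "'a set \<Rightarrow> nat \<Rightarrow> bool" where
  "forces_rainbow X n \<longleftrightarrow> (\<forall>L. linear_extension X (Restr R X) L \<longrightarrow>
     (\<exists>F \<subseteq> cover_edges (Restr R X). finite F \<and> rainbow L F \<and> card F = n))"

text \<open>The linear extension is restricted to \<open>Y\<close>, and the resulting rainbow is
  read in \<open>X\<close>. The description of its edges has the form that
  \<open>gate_rainbow\<close> expects.\<close>

lemma forces_rainbow_subset:
  assumes "forces_rainbow Y n" "Y \<subseteq> X" "linear_extension X (Restr R X) L"
    and "cover_edges (Restr R Y) \<subseteq> cover_edges (Restr R X)"
  shows "\<exists>F \<subseteq> cover_edges (Restr R X). finite F \<and> rainbow L F \<and> card F = n \<and>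
    (\<forall>f\<in>F. \<exists>a\<in>Y. \<exists>b\<in>Y. f = {a, b} \<and> (a, b) \<in> L)"
proof -
  have "Restr (Restr R X) Y = Restr R Y" using assms(2) by auto
  then have L: "linear_extension Y (Restr R Y) (Restr L Y)"
    using linear_extension_restrict[OF assms(3,2)] by simp
  then obtain F where F: "F \<subseteq> cover_edges (Restr R Y)" "finite F" "rainbow (Restr L Y) F" "card F = n"
    using assms(1) unfolding forces_rainbow_def by blast
  have "rainbow L F"
    by (rule rainbow_mono[OF F(3), of UNIV]) auto
  moreover have "\<exists>a\<in>Y. \<exists>b\<in>Y. f = {a, b} \<and> (a, b) \<in> L" if f: "f \<in> F" for f
  proof -
    obtain a b where "a \<in> Y" "b \<in> Y" "f = {a, b}" "(a, b) \<in> R"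
      by (rule cover_edgesE[OF subsetD[OF F(1) f]])
    moreover from this have "(a, b) \<in> L" using L unfolding linear_extension_def by blast
    ultimately show ?thesis by blast
  qed
  ultimately show ?thesis using F assms(4) by blast
qed

text \<open>
  Induction on the width: the new poset is a tower \<open>D < C < C' < B\<close> with two copies \<open>C\<close>, \<open>C'\<close>
  of the previous poset, together with a chain \<open>zu ` B < zl ` D\<close> to the left of it. The element
  \<open>zu e\<close> is covered by \<open>e \<in> B\<close>, and \<open>zl p\<close> covers \<open>p \<in> D\<close>. In a linear extension either all of
  \<open>zu ` B\<close> precedes \<open>C'\<close>, or all of \<open>zl ` D\<close> follows \<open>C\<close>.
\<close>

lemma forcing_set_exists:
  "\<exists>K\<ge>0. \<forall>N. \<exists>S. finite S \<and> in_box g h N (N + K) S \<and> chain_cover S R (Suc w) \<and>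
     (\<exists>A. antichain S (Restr R S) A \<and> card A = Suc w) \<and> forces_rainbow S (2 * w)"
proof (induction w)
  case 0
  show ?case
  proof (intro exI[of _ 0] conjI allI)
    fix N :: int
    have "forces_rainbow {pt N N} (2 * 0)"
      unfolding forces_rainbow_def by (intro allI impI exI[of _ "{}"]) (simp add: rainbow_def)
    then show "\<exists>S. finite S \<and> in_box g h N (N + 0) S \<and> chain_cover S R (Suc 0) \<and>
        (\<exists>A. antichain S (Restr R S) A \<and> card A = Suc 0) \<and> forces_rainbow S (2 * 0)"
      by (intro exI[of _ "{pt N N}"] conjI)
        (auto simp: in_box_def antichain_def chain_cover_singleton)
  qed simp
next
  case (Suc v)
  obtain m where m: "m \<ge> 0" and C_exists: "\<And>N. \<exists>S. finite S \<and> in_box g h N (N + m) S \<and>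
     chain_cover S R (Suc v) \<and> (\<exists>A. antichain S (Restr R S) A \<and> card A = Suc v) \<and>
     forces_rainbow S (2 * v)"
    using Suc by blast
  obtain k where k: "k \<ge> 0" and B_exists: "\<And>N. \<exists>B F t. finite B \<and> in_box g h N (N + k) B \<and>
     inj_on h B \<and> chain_cover B R (Suc v) \<and> F \<subseteq> cover_edges (Restr R B) \<and> finite F \<and>
     card F = Suc (2 * v) \<and> rainbow {(a, b). h a < h b} F \<and> t \<in> B \<and>
     (\<forall>f\<in>F. \<exists>a\<in>B. \<exists>b\<in>B. f = {a, b} \<and> h a < h b \<and> h b < h t)"
    using topped_h_rainbow_exists[of v] by blast
  obtain l where l: "l \<ge> 0" and D_exists: "\<And>N. \<exists>B F t. finite B \<and> in_box g h N (N + l) B \<and>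
     inj_on g B \<and> chain_cover B R (Suc v) \<and> F \<subseteq> cover_edges (Restr R B) \<and> finite F \<and>
     card F = Suc (2 * v) \<and> rainbow {(a, b). - g a < - g b} F \<and> t \<in> B \<and>
     (\<forall>f\<in>F. \<exists>a\<in>B. \<exists>b\<in>B. f = {a, b} \<and> - g a < - g b \<and> - g b < - g t)"
    using bottomed_g_rainbow_exists[of v] by blast
  show ?case
  \<comment> \<open>The bound is the highest row available to \<open>zl\<close>, namely
    \<open>l + b + k + 1\<close>, measured from \<open>N\<close>.\<close>
  proof (intro exI[of _ "2 * k + 2 * l + 2 * m + 6"] conjI allI)
    show "0 \<le> 2 * k + 2 * l + 2 * m + 6" using k l m by simp
    fix N :: int
    \<comment> \<open>The columns \<open>N\<close> to \<open>N + k\<close> are reserved for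
      \<open>zu\<close>, and the summand 2 in \<open>c\<close> leaves the column
      \<open>d + l + 1\<close> to \<open>zl\<close>.\<close>
    define d where "d = N + k + 1"
    define c where "c = d + l + 2"
    define c' where "c' = c + m + 1"
    define b where "b = c' + m + 1"
    note coords = d_def c_def c'_def b_def
    obtain D FD s where D: "finite D" "in_box g h d (d + l) D" "inj_on g D"
      "chain_cover D R (Suc v)" "FD \<subseteq> cover_edges (Restr R D)" "finite FD"
      "card FD = Suc (2 * v)" "rainbow {(a, b). - g a < - g b} FD" "s \<in> D"
      "\<forall>f\<in>FD. \<exists>a\<in>D. \<exists>b\<in>D. f = {a, b} \<and> - g a < - g b \<and> - g b < - g s"
      using D_exists[of d] by blast
    obtain C A where C: "finite C" "in_box g h c (c + m) C" "chain_cover C R (Suc v)"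
      "antichain C (Restr R C) A" "card A = Suc v" "forces_rainbow C (2 * v)"
      using C_exists[of c] by blast
    obtain C' A' where C': "finite C'" "in_box g h c' (c' + m) C'" "chain_cover C' R (Suc v)"
      "antichain C' (Restr R C') A'" "card A' = Suc v" "forces_rainbow C' (2 * v)"
      using C_exists[of c'] by blast
    obtain B FB t where B: "finite B" "in_box g h b (b + k) B" "inj_on h B"
      "chain_cover B R (Suc v)" "FB \<subseteq> cover_edges (Restr R B)" "finite FB"
      "card FB = Suc (2 * v)" "rainbow {(a, b). h a < h b} FB" "t \<in> B"
      "\<forall>f\<in>FB. \<exists>a\<in>B. \<exists>b\<in>B. f = {a, b} \<and> h a < h b \<and> h b < h t"
      using B_exists[of b] by blast
    \<comment> \<open>The point \<open>zu e\<close> lies in the row just under \<open>e\<close>, and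
      its column copies \<open>h e\<close>; \<open>zl p\<close> lies in the column just after
      \<open>p\<close>, and its row copies \<open>g p\<close>. So the left chain dictates the
      \<open>h\<close>-order on \<open>B\<close> and the \<open>g\<close>-order on
      \<open>D\<close>.\<close>
    define zu where "zu e = pt (h e - b + N) (h e - 1)" for e
    define zl where "zl p = pt (g p + 1) (g p - d + b + k + 1)" for p
    define S where "S = D \<union> C \<union> C' \<union> B \<union> (zu ` B \<union> zl ` D)"
    have z [simp]: "g (zu e) = h e - b + N" "h (zu e) = h e - 1"
      "g (zl p) = g p + 1" "h (zl p) = g p - d + b + k + 1" for e p
      by (simp_all add: zu_def zl_def)
    have boxD: "d \<le> g p" "g p \<le> d + l" "d \<le> h p" "h p \<le> d + l" if "p \<in> D" for p
      using D(2) that by (auto simp: in_box_def)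
    have boxC: "c \<le> g p" "g p \<le> c + m" "c \<le> h p" "h p \<le> c + m" if "p \<in> C" for p
      using C(2) that by (auto simp: in_box_def)
    have boxC': "c' \<le> g p" "g p \<le> c' + m" "c' \<le> h p" "h p \<le> c' + m" if "p \<in> C'" for p
      using C'(2) that by (auto simp: in_box_def)
    have boxB: "b \<le> g p" "g p \<le> b + k" "b \<le> h p" "h p \<le> b + k" if "p \<in> B" for p
      using B(2) that by (auto simp: in_box_def)
    have S_cases: thesis if "x \<in> S" "x \<in> D \<Longrightarrow> thesis" "x \<in> C \<Longrightarrow> thesis" "x \<in> C' \<Longrightarrow> thesis"
      "x \<in> B \<Longrightarrow> thesis" "\<And>e. e \<in> B \<Longrightarrow> x = zu e \<Longrightarrow> thesis" "\<And>p. p \<in> D \<Longrightarrow> x = zl p \<Longrightarrow> thesis"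
      for x thesis
      using that unfolding S_def by blast
    have sub: "D \<subseteq> S" "C \<subseteq> S" "C' \<subseteq> S" "B \<subseteq> S" "zu ` B \<subseteq> S" "zl ` D \<subseteq> S"
      by (auto simp: S_def)

    have DC: "(p, q) \<in> R" if "p \<in> D" "q \<in> C" for p q
      using boxD[OF that(1)] boxC[OF that(2)] by (simp add: coords)
    have DC': "(p, q) \<in> R" if "p \<in> D" "q \<in> C'" for p q
      using boxD[OF that(1)] boxC'[OF that(2)] m by (simp add: coords)
    have DB: "(p, q) \<in> R" if "p \<in> D" "q \<in> B" for p q
      using boxD[OF that(1)] boxB[OF that(2)] m by (simp add: coords)
    have CC': "(p, q) \<in> R" if "p \<in> C" "q \<in> C'" for p q
      using boxC[OF that(1)] boxC'[OF that(2)] by (simp add: coords)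
    have CB: "(p, q) \<in> R" if "p \<in> C" "q \<in> B" for p q
      using boxC[OF that(1)] boxB[OF that(2)] m by (simp add: coords)
    have C'B: "(p, q) \<in> R" if "p \<in> C'" "q \<in> B" for p q
      using boxC'[OF that(1)] boxB[OF that(2)] by (simp add: coords)
    have zuzu: "(zu e, zu f) \<in> R \<longleftrightarrow> h e < h f" for e f
      unfolding in_below z by linarith
    have zlzl: "(zl p, zl q) \<in> R \<longleftrightarrow> g p < g q" for p q
      unfolding in_below z by linarith
    have zuzl: "(zu e, zl p) \<in> R" if "e \<in> B" "p \<in> D" for e p
      using boxB[OF that(1)] boxD[OF that(2)] l by (simp add: coords)

    have "finite S" using B(1) C(1) C'(1) D(1) by (simp add: S_def)
    moreover have "in_box g h N (N + (2 * k + 2 * l + 2 * m + 6)) S"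
      unfolding in_box_def
    proof
      fix x assume "x \<in> S"
      then show "N \<le> g x \<and> g x \<le> N + (2 * k + 2 * l + 2 * m + 6) \<and>
          N \<le> h x \<and> h x \<le> N + (2 * k + 2 * l + 2 * m + 6)"
      proof (rule S_cases)
        assume "x \<in> D"
        from boxD[OF this] show ?thesis using k l m by (simp add: coords)
      next
        assume "x \<in> C"
        from boxC[OF this] show ?thesis using k l m by (simp add: coords)
      next
        assume "x \<in> C'"
        from boxC'[OF this] show ?thesis using k l m by (simp add: coords)
      next
        assume "x \<in> B"
        from boxB[OF this] show ?thesis using k l m by (simp add: coords)
      next
        fix e assume "e \<in> B" "x = zu e"
        with boxB[of e] show ?thesis using k l m by (simp add: coords)
      next
        fix p assume "p \<in> D" "x = zl p"
        with boxD[of p] show ?thesis using k l m by (simp add: coords)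
      qed
    qed
    moreover have "chain_cover S R (Suc (Suc v))"
      unfolding S_def
    proof (rule chain_cover_parallel)
      show "chain_cover (D \<union> C \<union> C' \<union> B) R (Suc v)"
        by (intro chain_cover_series B(4) C(3) C'(3) D(4))
          (auto simp del: in_below intro: DC DC' DB CC' CB C'B)
    next
      fix x y assume xy: "x \<in> zu ` B \<union> zl ` D" "y \<in> zu ` B \<union> zl ` D"
      have "zu e = zu f \<or> (zu e, zu f) \<in> R \<or> (zu f, zu e) \<in> R" for e f
        unfolding zuzu by (simp add: zu_def) linarith
      moreover have "zl p = zl q \<or> (zl p, zl q) \<in> R \<or> (zl q, zl p) \<in> R" for p q
        unfolding zlzl by (simp add: zl_def) linarith
      ultimately show "x = y \<or> (x, y) \<in> R \<or> (y, x) \<in> R"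
        using xy zuzl by (auto simp del: in_below)
    qed
    moreover have "\<exists>A. antichain S (Restr R S) A \<and> card A = Suc (Suc v)"
    proof (intro exI conjI)
      have AC: "A \<subseteq> C" using C(4) by (simp add: antichain_def)
      have A: "(x, y) \<notin> R" if "x \<in> A" "y \<in> A" "x \<noteq> y" for x y
        using C(4) AC that by (auto simp: antichain_def simp del: in_below)
      \<comment> \<open>The point \<open>zu t\<close> is to the left of \<open>C\<close> and above
        all its rows, so it enlarges the antichain of \<open>C\<close>.\<close>
      have zA: "(zu t, a) \<notin> R" "(a, zu t) \<notin> R" "a \<noteq> zu t" if "a \<in> A" for a
        using boxC[of a] boxB[OF B(9)] AC that l m by (auto simp: coords)
      show "antichain S (Restr R S) (insert (zu t) A)"
        using A AC zA sub B(9) unfolding antichain_def by (auto simp del: in_below)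
      show "card (insert (zu t) A) = Suc (Suc v)"
      proof (subst card_insert_disjoint)
        show "finite A" using C(5) by (intro card_ge_0_finite) simp
      qed (use C(5) zA(3) in auto)
    qed
    moreover have "forces_rainbow S (2 * Suc v)"
      unfolding forces_rainbow_def
    proof (intro allI impI)
      fix L assume ext: "linear_extension S (Restr R S) L"
      let ?E = "cover_edges (Restr R S)"
      have L: "trans L" "irrefl L" and L_total: "total_on S L" and RL: "Restr R S \<subseteq> L"
        using ext unfolding linear_extension_def strict_linear_order_on_def by auto
      have total: "(x, y) \<in> L \<or> (y, x) \<in> L" if "x \<in> S" "y \<in> S" "x \<noteq> y" for x y
        using L_total that by (simp add: total_on_def)
      have inL: "(x, y) \<in> L" if "x \<in> S" "y \<in> S" "(x, y) \<in> R" for x y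
        using RL that by blast

      \<comment> \<open>Coarse positions that suffice for the convexity of all four floors:
        \<open>zu e\<close> is left of every floor, while \<open>zl p\<close> is left of
        \<open>C\<close> and higher than \<open>B\<close>.\<close>
      have S_box: "(x \<in> D \<and> g x \<le> d + l) \<or> (x \<in> C \<and> c \<le> g x \<and> g x \<le> c + m) \<or>
          (x \<in> C' \<and> c' \<le> g x \<and> g x \<le> c' + m) \<or> (x \<in> B \<and> b \<le> g x) \<or>
          g x < d \<or> (g x < c \<and> b + k < h x)" if "x \<in> S" for x
        using that
      proof (rule S_cases)
        fix e assume "e \<in> B" "x = zu e"
        with boxB[of e] show ?thesis by (simp add: coords)
      next
        fix p assume "p \<in> D" "x = zl p"
        with boxD[of p] show ?thesis by (simp add: coords)
      qed (use boxD[of x] boxC[of x] boxC'[of x] boxB[of x] in simp_all)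

      have ED: "cover_edges (Restr R D) \<subseteq> ?E"
      proof (rule cover_edges_convex[OF sub(1)])
        fix p q x assume p: "p \<in> D" and q: "q \<in> D" and x: "x \<in> S"
          and "(p, x) \<in> R" "(x, q) \<in> R"
        then have "g p < g x" "g x < g q" "h x < h q" by simp_all
        with S_box[OF x] show "x \<in> D"
          using boxD[OF p] boxD[OF q] k l m coords by (elim disjE conjE; (assumption | linarith))
      qed
      have EC: "cover_edges (Restr R C) \<subseteq> ?E"
      proof (rule cover_edges_convex[OF sub(2)])
        fix p q x assume p: "p \<in> C" and q: "q \<in> C" and x: "x \<in> S"
          and "(p, x) \<in> R" "(x, q) \<in> R"
        then have "g p < g x" "g x < g q" "h x < h q" by simp_all
        with S_box[OF x] show "x \<in> C"
          using boxC[OF p] boxC[OF q] k l m coords by (elim disjE conjE; (assumption | linarith))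
      qed
      have EC': "cover_edges (Restr R C') \<subseteq> ?E"
      proof (rule cover_edges_convex[OF sub(3)])
        fix p q x assume p: "p \<in> C'" and q: "q \<in> C'" and x: "x \<in> S"
          and "(p, x) \<in> R" "(x, q) \<in> R"
        then have "g p < g x" "g x < g q" "h x < h q" by simp_all
        with S_box[OF x] show "x \<in> C'"
          using boxC'[OF p] boxC'[OF q] k l m coords by (elim disjE conjE; (assumption | linarith))
      qed
      have EB: "cover_edges (Restr R B) \<subseteq> ?E"
      proof (rule cover_edges_convex[OF sub(4)])
        fix p q x assume p: "p \<in> B" and q: "q \<in> B" and x: "x \<in> S"
          and "(p, x) \<in> R" "(x, q) \<in> R"
        then have "g p < g x" "g x < g q" "h x < h q" by simp_all
        with S_box[OF x] show "x \<in> B"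
          using boxB[OF p] boxB[OF q] k l m coords by (elim disjE conjE; (assumption | linarith))
      qed
      \<comment> \<open>Consecutive rows leave no room between \<open>zu e\<close> and
        \<open>e\<close>; for \<open>zl p\<close> and \<open>p\<close> the columns are
        consecutive.\<close>
      have zuE: "{zu e, e} \<in> ?E" if "e \<in> B" for e
      proof -
        have "(zu e, e) \<in> R" using boxB[OF that] k l m by (simp add: coords)
        then have "covers (Restr R S) (zu e) e"
          using that sub by (auto simp: covers_def)
        then show ?thesis unfolding cover_edges_def by blast
      qed
      have zlE: "{zl p, p} \<in> ?E" if "p \<in> D" for p
      proof -
        have "(p, zl p) \<in> R" using boxD[OF that] k l m by (simp add: coords)
        then have "covers (Restr R S) p (zl p)"
          using that sub by (auto simp: covers_def)
        then show ?thesis unfolding cover_edges_def by (auto simp: insert_commute)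
      qed

      have "\<exists>F \<subseteq> ?E. finite F \<and> rainbow L F \<and> card F = Suc (Suc (2 * v))"
      \<comment> \<open>If some \<open>zl p\<close> precedes some \<open>x\<close> in
        \<open>C\<close>, then every \<open>zu e\<close> precedes \<open>zl p\<close>, hence
        \<open>x\<close>, hence all of \<open>C'\<close>; the second copy turns one early element
        into a whole floor. Otherwise totality puts every \<open>zl p\<close> after all of
        \<open>C\<close>.\<close>
      proof (cases "\<exists>p\<in>D. \<exists>x\<in>C. (zl p, x) \<in> L")
        case True
        then obtain p x where px: "p \<in> D" "x \<in> C" "(zl p, x) \<in> L" by blast
        obtain F where F: "F \<subseteq> ?E" "finite F" "rainbow L F" "card F = 2 * v"
          "\<forall>f\<in>F. \<exists>a\<in>C'. \<exists>b\<in>C'. f = {a, b} \<and> (a, b) \<in> L"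
          using forces_rainbow_subset[OF C'(6) sub(3) ext EC'] by blast
        show ?thesis
        proof (rule gate_rainbow[OF L F(3,1,2,4) _ B(8) _ B(6,7) _ B(9,3)])
          show "\<exists>a\<in>C'. \<exists>b\<in>C'. f = {a, b} \<and> (a, b) \<in> L" if "f \<in> F" for f
            using F(5) that by blast
          show "FB \<subseteq> ?E" using B(5) EB by blast
          show "\<exists>a\<in>B. \<exists>b\<in>B. f = {a, b} \<and> h a < h b \<and> h b < h t" if "f \<in> FB" for f
            using B(10) that by blast
          show "(e, f) \<in> L \<or> (f, e) \<in> L" if "e \<in> B" "f \<in> B" "e \<noteq> f" for e f
            using total sub(4) that by blast
          show "{zu e, e} \<in> ?E" if "e \<in> B" for e by (rule zuE[OF that])
          show "(zu e, zu f) \<in> L" if "e \<in> B" "f \<in> B" "h e < h f" for e f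
            using that sub(5) zuzu by (intro inL) auto
          show "(y, e) \<in> L" if "e \<in> B" "y \<in> C'" for e y
            using that sub by (intro inL C'B) auto
          show "(zu e, y) \<in> L" if "e \<in> B" "y \<in> C'" for e y
          proof -
            have "(zu e, zl p) \<in> L" using that sub px by (intro inL zuzl) auto
            moreover have "(x, y) \<in> L" using that sub px by (intro inL CC') auto
            ultimately show ?thesis using px(3) L(1) by (meson transD)
          qed
          show "C' \<noteq> {}" using C'(4,5) unfolding antichain_def by auto
        qed
      next
        case False
        have Czl: "(x, zl p) \<in> L" if "p \<in> D" "x \<in> C" for p x
        proof -
          have "x \<noteq> zl p" using boxC[OF that(2)] boxD[OF that(1)] by (auto simp: coords)
          then show ?thesis using total[of x "zl p"] False that sub by blast
        qed
        obtain F where F: "F \<subseteq> ?E" "finite F" "rainbow L F" "card F = 2 * v"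
          "\<forall>f\<in>F. \<exists>a\<in>C. \<exists>b\<in>C. f = {a, b} \<and> (a, b) \<in> L"
          using forces_rainbow_subset[OF C(6) sub(2) ext EC] by blast
        have Lc: "trans (L\<inverse>)" "irrefl (L\<inverse>)" "rainbow (L\<inverse>) F" "inj_on (\<lambda>p. - g p) D"
          using L F(3) D(3) by (auto simp: rainbow_converse irrefl_def inj_on_def)
        \<comment> \<open>In the reversed order \<open>zl\<close> comes first, then
          \<open>C\<close>, then \<open>D\<close>, and the dictated order on \<open>D\<close> is
          that of \<open>- g\<close>.\<close>
        have "\<exists>F \<subseteq> ?E. finite F \<and> rainbow (L\<inverse>) F \<and> card F = Suc (Suc (2 * v))"
        proof (rule gate_rainbow[OF Lc(1-3) F(1,2,4) _ D(8) _ D(6,7) _ D(9) Lc(4)])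
          show "\<exists>a\<in>C. \<exists>b\<in>C. f = {a, b} \<and> (a, b) \<in> L\<inverse>" if "f \<in> F" for f
            using F(5) that by (metis converse_iff insert_commute)
          show "FD \<subseteq> ?E" using D(5) ED by blast
          show "\<exists>a\<in>D. \<exists>b\<in>D. f = {a, b} \<and> - g a < - g b \<and> - g b < - g s" if "f \<in> FD" for f
            using D(10) that by blast
          show "(e, f) \<in> L\<inverse> \<or> (f, e) \<in> L\<inverse>" if "e \<in> D" "f \<in> D" "e \<noteq> f" for e f
            using total sub(1) that by blast
          show "{zl e, e} \<in> ?E" if "e \<in> D" for e by (rule zlE[OF that])
          show "(zl e, zl f) \<in> L\<inverse>" if "e \<in> D" "f \<in> D" "- g e < - g f" for e f
            unfolding converse_iff using that sub(6) zlzl by (intro inL) auto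
          show "(y, e) \<in> L\<inverse>" if "e \<in> D" "y \<in> C" for e y
            unfolding converse_iff using that sub by (intro inL DC) auto
          show "(zl e, y) \<in> L\<inverse>" if "e \<in> D" "y \<in> C" for e y
            using Czl that by simp
          show "C \<noteq> {}" using C(4,5) unfolding antichain_def by auto
        qed
        then show ?thesis by (simp add: rainbow_converse)
      qed
      then show "\<exists>F \<subseteq> ?E. finite F \<and> rainbow L F \<and> card F = 2 * Suc v" by simp
    qed
    ultimately show "\<exists>S. finite S \<and> in_box g h N (N + (2 * k + 2 * l + 2 * m + 6)) S \<and>
        chain_cover S R (Suc (Suc v)) \<and>
        (\<exists>A. antichain S (Restr R S) A \<and> card A = Suc (Suc v)) \<and> forces_rainbow S (2 * Suc v)"
      by blast
  qed
qed

end

section \<open>Dimension, width and queue number\<close>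

lemma finite_poset_below: "finite X \<Longrightarrow> finite_poset X (Restr (below g h) X)"
  by (auto simp: finite_poset_def trans_def asym_on_def)

text \<open>Points with equal first coordinates are incomparable, so ties are broken in reverse.\<close>

lemma linear_extension_lex:
  assumes "inj_on (\<lambda>p. (g p, h p)) X"
  shows "linear_extension X (Restr (below g h) X)
    {(a, b). a \<in> X \<and> b \<in> X \<and> (g a < g b \<or> g a = g b \<and> h b < h a)}" (is "linear_extension X _ ?L")
proof -
  have "trans ?L" by (auto simp: trans_def)
  moreover have "irrefl ?L" by (auto simp: irrefl_def)
  moreover have "total_on X ?L"
  proof (rule total_onI)
    fix a b assume ab: "a \<in> X" "b \<in> X" "a \<noteq> b"
    then have "g a \<noteq> g b \<or> h a \<noteq> h b" using assms by (auto simp: inj_on_def)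
    then show "(a, b) \<in> ?L \<or> (b, a) \<in> ?L" using ab by auto
  qed
  ultimately show ?thesis
    by (auto simp: linear_extension_def strict_linear_order_on_def)
qed

text \<open>The two lexicographic orders form a realizer. Conversely, two incomparable elements must
  appear in both orders, which takes two linear extensions.\<close>

lemma poset_dimension_below:
  assumes inj: "inj_on (\<lambda>p. (g p, h p)) X"
    and A: "antichain X (Restr (below g h) X) A" "card A \<ge> 2"
  shows "poset_dimension X (Restr (below g h) X) = 2"
  unfolding poset_dimension_def
proof (rule Least_equality)
  let ?r = "Restr (below g h) X"
  let ?L = "\<lambda>g h. {(a, b). a \<in> X \<and> b \<in> X \<and> (g a < g b \<or> g a = g b \<and> h b < (h a :: int))}"
  have "inj_on (\<lambda>p. (h p, g p)) X" using inj by (auto simp: inj_on_def)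
  then have "linear_extension X (Restr (below h g) X) (?L h g)" by (rule linear_extension_lex)
  moreover have "below h g = below g h" by (auto simp: below_def)
  ultimately have swapped: "linear_extension X ?r (?L h g)" by simp
  have two: "(\<forall>i<2. P i) \<longleftrightarrow> P 0 \<and> P 1" for P :: "nat \<Rightarrow> bool"
    by (auto simp: less_2_cases_iff)
  have "realizer X ?r 2 (\<lambda>i. if i = 0 then ?L g h else ?L h g)"
    unfolding realizer_def two using linear_extension_lex[OF inj] swapped by auto
  then show "\<exists>L. realizer X ?r 2 L" by blast
next
  let ?r = "Restr (below g h) X"
  fix d assume "\<exists>L. realizer X ?r d L"
  then obtain L where ext: "\<And>i. i < d \<Longrightarrow> linear_extension X ?r (L i)"
    and r: "\<And>a b. a \<in> X \<Longrightarrow> b \<in> X \<Longrightarrow> (a, b) \<in> ?r \<longleftrightarrow> (\<forall>i<d. (a, b) \<in> L i)"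
    unfolding realizer_def by blast
  have "finite A" using A(2) by (intro card_ge_0_finite) simp
  then obtain a b where ab: "a \<in> A" "b \<in> A" "a \<noteq> b"
    using A(2) card_le_Suc0_iff_eq[of A] by (auto simp: numeral_2_eq_2)
  have X: "a \<in> X" "b \<in> X" and not_r: "(a, b) \<notin> ?r" "(b, a) \<notin> ?r"
    using antichainD[OF A(1)] ab subsetD[OF antichain_subset[OF A(1)]] by metis+
  \<comment> \<open>This also excludes \<open>d = 0\<close>, for which the condition on all
    \<open>i < d\<close> would hold vacuously.\<close>
  have "\<not> (\<forall>i<d. (a, b) \<in> L i)" "\<not> (\<forall>i<d. (b, a) \<in> L i)"
    using r[OF X] r[OF X(2,1)] not_r by simp_all
  then obtain i j where i: "i < d" "(a, b) \<notin> L i" and j: "j < d" "(b, a) \<notin> L j" by blast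
  have "total_on X (L i)"
    using ext[OF i(1)] by (simp add: linear_extension_def strict_linear_order_on_def)
  then have "(b, a) \<in> L i" using X ab(3) i(2) by (auto simp: total_on_def)
  then have "i \<noteq> j" using j(2) by blast
  with i(1) j(1) show "2 \<le> d" by simp
qed

lemma poset_width_eq:
  assumes "finite X" "chain_cover X r w" "antichain X (Restr r X) A" "card A = w"
  shows "poset_width X (Restr r X) = w"
  unfolding poset_width_def
proof (rule Max_eqI)
  have "{A. antichain X (Restr r X) A} \<subseteq> Pow X" by (auto simp: antichain_def)
  then show "finite (card ` {A. antichain X (Restr r X) A})"
    using assms(1) by (meson finite_Pow_iff finite_imageI finite_subset)
  show "y \<le> w" if "y \<in> card ` {A. antichain X (Restr r X) A}" for y
    using antichain_card_le[OF assms(2)] that by auto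
  show "w \<in> card ` {A. antichain X (Restr r X) A}" using assms(3,4) by auto
qed

text \<open>The linear extension \<open>M\<close> guarantees that some layout exists, so that the
  least \<open>k\<close> is attained by a layout to which \<open>rainbow_card_le\<close>
  applies.\<close>

lemma queue_number_ge:
  assumes "finite X" "r \<subseteq> X \<times> X" "linear_extension X r M"
    and rainbows: "\<And>L. linear_extension X r L \<Longrightarrow>
      \<exists>F \<subseteq> cover_edges r. finite F \<and> rainbow L F \<and> card F = n"
  shows "n \<le> queue_number X r"
proof -
  let ?P = "\<lambda>k. \<exists>L q. linear_extension X r L \<and> queue_layout (cover_edges r) L k q"
  have M: "trans M" "irrefl M"
    using assms(3) by (auto simp: linear_extension_def strict_linear_order_on_def)
  have "cover_edges r \<subseteq> Pow X" using assms(2) by (auto simp: cover_edges_def covers_def)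
  \<comment> \<open>One queue per edge gives a layout, since no edge nests in itself.\<close>
  then have "finite (cover_edges r)" using assms(1) by (meson finite_Pow_iff finite_subset)
  then obtain q and k :: nat where "q ` cover_edges r = {i. i < k}" "inj_on q (cover_edges r)"
    using finite_imp_inj_to_nat_seg by metis
  then have "queue_layout (cover_edges r) M k q"
    using not_nested_self[OF M] by (auto simp: queue_layout_def dest: inj_onD)
  then have "?P k" using assms(3) by blast
  then have "?P (queue_number X r)" unfolding queue_number_def by (rule LeastI)
  then obtain L q where L: "linear_extension X r L" "queue_layout (cover_edges r) L (queue_number X r) q"
    by blast
  obtain F where "F \<subseteq> cover_edges r" "finite F" "rainbow L F" "card F = n"
    using rainbows[OF L(1)] by blast
  with L(2) show ?thesis using rainbow_card_le by blast
qed

theorem theorem1: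
  fixes w :: nat
  assumes "w > 1"
  shows "\<exists>(X :: nat set) (r :: nat rel). finite_poset X r \<and> poset_dimension X r = 2 \<and>
           poset_width X r = w \<and> queue_number X r \<ge> 2 * (w - 1)"
proof -
  \<comment> \<open>Natural numbers encode pairs of integers bijectively, so a point is determined
    by its coordinates.\<close>
  define g h where gh: "g n = int_decode (fst (prod_decode n))"
    "h n = int_decode (snd (prod_decode n))" for n
  interpret plane g h "\<lambda>x y. prod_encode (int_encode x, int_encode y)"
    by unfold_locales (simp_all add: gh)
  have inj: "inj_on (\<lambda>p. (g p, h p)) X" for X
  proof (rule inj_onI)
    fix p q assume "(g p, h p) = (g q, h q)"
    then have "prod_decode p = prod_decode q"
      by (simp add: gh prod_eq_iff int_decode_eq)
    then show "p = q" by simp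
  qed
  obtain X A where X: "finite X" "chain_cover X R w" "antichain X (Restr R X) A" "card A = w"
    "forces_rainbow X (2 * (w - 1))"
    using forcing_set_exists[of "w - 1"] assms by auto
  have "finite_poset X (Restr R X)" using X(1) by (rule finite_poset_below)
  moreover have "poset_dimension X (Restr R X) = 2"
    using poset_dimension_below[OF inj X(3)] X(4) assms by simp
  moreover have "poset_width X (Restr R X) = w"
    using X(1-4) by (rule poset_width_eq)
  moreover have "2 * (w - 1) \<le> queue_number X (Restr R X)"
    using X(5) by (intro queue_number_ge[OF X(1) _ linear_extension_lex[OF inj]])
      (auto simp: forces_rainbow_def)
  ultimately show ?thesis by blast
qed

end
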